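(* Let $A\in\mathbb{R}^{n\times n}$ be symmetric positive definite and let $\widetilde{M}=M(M+M^T-A)^{-1}M^T$ be the symmetric Gauss-Seidel smoother, where $M$ is the lower triangular part of $A$ including the diagonal. Let $\lambda_1\le\cdots\le\lambda_n$ and $\mathbf{v}_1,\dots,\mathbf{v}_n$ be the eigenvalues and $\widetilde{M}$-orthonormal eigenvectors of $A\mathbf{x}=\lambda\widetilde{M}\mathbf{x}$, and let $S_\sharp=\begin{pmatrix}\mathbf{v}_{n_c+1}&\cdots&\mathbf{v}_n\end{pmatrix}$. Then $$\widetilde{M}_{S_\sharp}:=S_\sharp^T\widetilde{M}S_\sharp=I,\qquad A_{S_\sharp}:=S_\sharp^TAS_\sharp=\Lambda_{S_\sharp}:=\operatorname{diag}(\lambda_{n_c+1},\dots,\lambda_n),$$ and the spectral radius of the compatible relaxation error propagation matrix $I-\widetilde{M}_{S_\sharp}^{-1}A_{S_\sharp}$ is $$\rho\big(I-\widetilde{M}_{S_\sharp}^{-1}A_{S_\sharp}\big)=1-\min_i(\Lambda_{S_\sharp})_{ii}=1-\lambda_{n_c+1}.$$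
   Context: Here $1\le n_c<n$. $\widetilde{M}$-orthonormal means $\mathbf{v}_i^T\widetilde{M}\mathbf{v}_j=\delta_{ij}$. For a smoother $N$ and a full column rank matrix $S$, compatible relaxation is the iteration $\mathbf{e}_{k+1}=(I-N_S^{-1}A_S)\mathbf{e}_k$ with $N_S=S^TNS$, $A_S=S^TAS$; here $N=\widetilde{M}$ and $S=S_\sharp$. *)

theory Defs
  imports "Jordan_Normal_Form.Spectral_Radius" "Jordan_Normal_Form.Gauss_Jordan_Elimination"
begin

(* The value is unspecified when A is not an invertible square matrix. *)
definition matinv :: "real mat \<Rightarrow> real mat" where
  "matinv A = the (mat_inverse A)"

(* The library's spectral radius is that of a complex matrix, so that all complex
   eigenvalues are taken into account. *)
definition real_spectral_radius :: "real mat \<Rightarrow> real" where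
  "real_spectral_radius A = spectral_radius (map_mat complex_of_real A)"

definition spd_mat :: "nat \<Rightarrow> real mat \<Rightarrow> bool" where
  "spd_mat n A \<longleftrightarrow> A \<in> carrier_mat n n \<and> transpose_mat A = A \<and>
     (\<forall>x \<in> carrier_vec n. x \<noteq> 0\<^sub>v n \<longrightarrow> 0 < x \<bullet> (A *\<^sub>v x))"

definition lower_part :: "real mat \<Rightarrow> real mat" where
  "lower_part A = mat (dim_row A) (dim_col A) (\<lambda>(i, j). if j \<le> i then A $$ (i, j) else 0)"

definition symmetrized :: "real mat \<Rightarrow> real mat \<Rightarrow> real mat" where
  "symmetrized A M = M * matinv (M + transpose_mat M - A) * transpose_mat M"

definition sym_gauss_seidel :: "real mat \<Rightarrow> real mat" where
  "sym_gauss_seidel A = symmetrized A (lower_part A)"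

definition gen_eigenvector :: "real mat \<Rightarrow> real mat \<Rightarrow> real vec \<Rightarrow> real \<Rightarrow> bool" where
  "gen_eigenvector A B x l \<longleftrightarrow>
     x \<in> carrier_vec (dim_row A) \<and> x \<noteq> 0\<^sub>v (dim_row A) \<and> A *\<^sub>v x = l \<cdot>\<^sub>v (B *\<^sub>v x)"

(* The sequences lam and v are indexed from 1 to n.  Since the n vectors are B-orthonormal,
   they form a basis, so lam lists all generalized eigenvalues with multiplicity. *)
definition ordered_gen_eigensystem ::
  "nat \<Rightarrow> real mat \<Rightarrow> real mat \<Rightarrow> (nat \<Rightarrow> real) \<Rightarrow> (nat \<Rightarrow> real vec) \<Rightarrow> bool" where
  "ordered_gen_eigensystem n A B lam v \<longleftrightarrow>
     (\<forall>i \<in> {1..n}. gen_eigenvector A B (v i) (lam i)) \<and>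
     (\<forall>i \<in> {1..n}. \<forall>j \<in> {1..n}. v i \<bullet> (B *\<^sub>v v j) = (if i = j then 1 else 0)) \<and>
     (\<forall>i \<in> {1..n}. \<forall>j \<in> {1..n}. i \<le> j \<longrightarrow> lam i \<le> lam j)"

definition S_sharp :: "nat \<Rightarrow> nat \<Rightarrow> (nat \<Rightarrow> real vec) \<Rightarrow> real mat" where
  "S_sharp n nc v = mat_of_cols n (map v [nc + 1 ..< n + 1])"

(* Column j (counted from 0) of S_sharp is v (nc + 1 + j), hence the shift. *)
definition Lambda_sharp :: "nat \<Rightarrow> nat \<Rightarrow> (nat \<Rightarrow> real) \<Rightarrow> real mat" where
  "Lambda_sharp n nc lam = mat_diag (n - nc) (\<lambda>i. lam (nc + 1 + i))"

definition restricted :: "real mat \<Rightarrow> real mat \<Rightarrow> real mat" where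
  "restricted S N = transpose_mat S * N * S"

(* The matrix E of the compatible relaxation iteration e' = E e with smoother N. *)
definition cr_error_propagation :: "real mat \<Rightarrow> real mat \<Rightarrow> real mat \<Rightarrow> real mat" where
  "cr_error_propagation A N S =
     1\<^sub>m (dim_col S) - matinv (restricted S N) * restricted S A"

end

theory Submission
  imports Defs
begin

text \<open>Orthonormality says directly that \<open>Mt\<close> restricts to the identity, and
  \<open>v i \<bullet> A v j = lam j * (v i \<bullet> Mt v j)\<close> that \<open>A\<close> restricts to the diagonal matrix of the remaining
  eigenvalues (\<open>index_restricted\<close>).  The error propagation matrix is therefore diagonal with
  entries \<open>1 - lam i\<close>, and its spectral radius is the largest \<open>\<bar>1 - lam i\<bar>\<close>
  (\<open>real_spectral_radius_mat_diag\<close>).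

  What remains is to remove the absolute values, that is, to see that no eigenvalue exceeds 1.
  For the lower triangular part \<open>M\<close> of a symmetric \<open>A\<close> the matrix \<open>M + M\<^sup>T - A\<close> is the diagonal \<open>D\<close>
  of \<open>A\<close>, whose entries are positive because \<open>A\<close> is positive definite.  Completing the square gives
  \<open>Mt - A = (M\<^sup>T - D)\<^sup>T * D\<inverse> * (M\<^sup>T - D)\<close>, which is positive semidefinite
  (\<open>symmetrized_dominates\<close>).  For an eigenvector normalized by \<open>v i \<bullet> Mt v i = 1\<close> this reads
  \<open>lam i = v i \<bullet> A v i \<le> 1\<close>.\<close>

section \<open>Inverses and spectral radii of diagonal matrices\<close>

lemma matinv_eqI:
  assumes A: "A \<in> carrier_mat n n" and B: "B \<in> carrier_mat n n"
    and AB: "A * B = 1\<^sub>m n" and BA: "B * A = 1\<^sub>m n"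
  shows "matinv A = B"
proof -
  have "A \<in> Units (ring_mat TYPE(real) n ())"
    using assms by (auto simp: Units_def ring_mat_def)
  then obtain C where C: "mat_inverse A = Some C"
    using mat_inverse(1)[OF A, of "()"] by (cases "mat_inverse A") auto
  have CA: "C * A = 1\<^sub>m n" and Cc: "C \<in> carrier_mat n n"
    using mat_inverse(2)[OF A C] by auto
  have "C = C * (A * B)" using AB Cc by simp
  also have "\<dots> = (C * A) * B" using assoc_mult_mat[OF Cc A B] by simp
  also have "\<dots> = B" using CA B by simp
  finally show ?thesis by (simp add: matinv_def C)
qed

lemma matinv_mat_diag:
  assumes "\<And>i. i < n \<Longrightarrow> d i \<noteq> 0"
  shows "matinv (mat_diag n d) = mat_diag n (\<lambda>i. inverse (d i))"
proof -
  have "mat_diag n (\<lambda>i. d i * inverse (d i)) = 1\<^sub>m n"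
    using assms by (intro eq_matI) (auto simp: mat_diag_def)
  then show ?thesis
    by (intro matinv_eqI[of _ n]) (simp_all add: mult.commute)
qed

lemma real_spectral_radius_mat_diag:
  "real_spectral_radius (mat_diag n f) = Max ((\<lambda>i. \<bar>f i\<bar>) ` {..<n})"
proof -
  let ?C = "map_mat complex_of_real (mat_diag n f)"
  have C: "?C \<in> carrier_mat n n" by simp
  have upper: "upper_triangular ?C"
    by (auto simp: upper_triangular_def mat_diag_def)
  have diag: "diag_mat ?C = map (\<lambda>i. complex_of_real (f i)) [0..<n]"
    by (auto simp: diag_mat_def mat_diag_def)
  have "spectrum ?C = (\<lambda>i. complex_of_real (f i)) ` {..<n}"
    unfolding spectrum_root_char_poly[OF C] char_poly_upper_triangular[OF C upper] diag
    by (auto simp: poly_prod_list prod_list_zero_iff)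
  then show ?thesis
    by (simp add: real_spectral_radius_def spectral_radius_def image_image)
qed

section \<open>The symmetrized smoother dominates the matrix\<close>

lemma scalar_prod_transpose_mult:
  fixes x y :: "real vec"
  assumes "B \<in> carrier_mat m n" "x \<in> carrier_vec n" "y \<in> carrier_vec m"
  shows "x \<bullet> (transpose_mat B *\<^sub>v y) = (B *\<^sub>v x) \<bullet> y"
  using transpose_vec_mult_scalar[OF assms] assms
  by (metis comm_scalar_prod mult_mat_vec_carrier transpose_carrier_mat)

lemma mat_diag_mult_vec:
  fixes d :: "nat \<Rightarrow> real"
  assumes "x \<in> carrier_vec n"
  shows "mat_diag n d *\<^sub>v x = vec n (\<lambda>i. d i * x $ i)"
proof (rule eq_vecI)
  fix i assume "i < dim_vec (vec n (\<lambda>i. d i * x $ i))"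
  then have i: "i < n" by simp
  have "(mat_diag n d *\<^sub>v x) $ i = (\<Sum>j<n. (if i = j then d j else 0) * x $ j)"
    using assms i by (simp add: mat_diag_def scalar_prod_def lessThan_atLeast0)
  also have "\<dots> = (\<Sum>j<n. if i = j then d j * x $ j else 0)"
    by (rule sum.cong) auto
  also have "\<dots> = d i * x $ i" using i by simp
  finally show "(mat_diag n d *\<^sub>v x) $ i = vec n (\<lambda>i. d i * x $ i) $ i" using i by simp
qed (simp add: mat_diag_def)

text \<open>With \<open>y = M\<^sup>T x\<close>, the two quadratic forms are \<open>\<Sum> (y i)\<^sup>2 / d i\<close> and
  \<open>\<Sum> (2 * x i * y i - d i * (x i)\<^sup>2)\<close>, so their difference is
  \<open>\<Sum> (y i - d i * x i)\<^sup>2 / d i\<close>.\<close>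

lemma symmetrized_dominates:
  assumes A: "A \<in> carrier_mat n n" and M: "M \<in> carrier_mat n n"
    and D: "M + transpose_mat M - A = mat_diag n d"
    and pos: "\<And>i. i < n \<Longrightarrow> 0 < d i"
    and x: "x \<in> carrier_vec n"
  shows "x \<bullet> (A *\<^sub>v x) \<le> x \<bullet> (symmetrized A M *\<^sub>v x)"
proof -
  let ?D = "mat_diag n d" and ?E = "mat_diag n (\<lambda>i. inverse (d i))"
  define y where "y = transpose_mat M *\<^sub>v x"
  have Mt: "transpose_mat M \<in> carrier_mat n n" using M by simp
  have y: "y \<in> carrier_vec n" using Mt x by (simp add: y_def)
  have E: "?E \<in> carrier_mat n n" by simp
  have "matinv ?D = ?E" using pos by (intro matinv_mat_diag) force
  then have "symmetrized A M *\<^sub>v x = M *\<^sub>v (?E *\<^sub>v y)"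
    using M Mt E x by (simp add: symmetrized_def D y_def assoc_mult_mat_vec[of _ n n _ n])
  then have "x \<bullet> (symmetrized A M *\<^sub>v x) = y \<bullet> (?E *\<^sub>v y)"
    using scalar_prod_transpose_mult[OF Mt x, of "?E *\<^sub>v y"] mult_mat_vec_carrier[OF E y]
    by (simp add: y_def)
  then have B: "x \<bullet> (symmetrized A M *\<^sub>v x) = (\<Sum>i<n. (y $ i)\<^sup>2 / d i)"
    using y by (simp add: mat_diag_mult_vec scalar_prod_def lessThan_atLeast0
        power2_eq_square divide_inverse mult_ac)
  have "A = M + transpose_mat M - ?D"
  proof (rule eq_matI)
    fix i j assume "i < dim_row (M + transpose_mat M - ?D)" "j < dim_col (M + transpose_mat M - ?D)"
    then have ij: "i < n" "j < n" by (auto simp: mat_diag_def)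
    have "(M + transpose_mat M - A) $$ (i, j) = ?D $$ (i, j)" by (simp add: D)
    then show "A $$ (i, j) = (M + transpose_mat M - ?D) $$ (i, j)"
      using ij A M by (simp add: mat_diag_def)
  qed (use A in \<open>auto simp: mat_diag_def\<close>)
  then have "A *\<^sub>v x = M *\<^sub>v x + y - ?D *\<^sub>v x"
    using M Mt x unfolding y_def
    by (metis add_carrier_mat add_mult_distrib_mat_vec mat_diag_dim minus_mult_distrib_mat_vec)
  then have "x \<bullet> (A *\<^sub>v x) = x \<bullet> (M *\<^sub>v x) + x \<bullet> y - x \<bullet> (?D *\<^sub>v x)"
    using M x y
    by (simp add: scalar_prod_minus_distrib[of _ n] scalar_prod_add_distrib[of _ n]
        mult_mat_vec_carrier[of _ n n])
  also have "x \<bullet> (M *\<^sub>v x) = x \<bullet> y"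
    using scalar_prod_transpose_mult[OF Mt x x] comm_scalar_prod[OF x y] by (simp add: y_def)
  also have "x \<bullet> y + x \<bullet> y - x \<bullet> (?D *\<^sub>v x) = (\<Sum>i<n. 2 * x $ i * y $ i - d i * (x $ i)\<^sup>2)"
    using x y by (simp add: mat_diag_mult_vec scalar_prod_def lessThan_atLeast0
        power2_eq_square sum_subtractf sum.distrib[symmetric] algebra_simps)
  also have "\<dots> \<le> (\<Sum>i<n. (y $ i)\<^sup>2 / d i)"
  proof (rule sum_mono)
    fix i assume "i \<in> {..<n}"
    then have d: "0 < d i" using pos by simp
    have "0 \<le> (y $ i - d i * x $ i)\<^sup>2 / d i" using d by simp
    also have "\<dots> = (y $ i)\<^sup>2 / d i - (2 * x $ i * y $ i - d i * (x $ i)\<^sup>2)"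
      using d by (simp add: field_simps power2_eq_square)
    finally show "2 * x $ i * y $ i - d i * (x $ i)\<^sup>2 \<le> (y $ i)\<^sup>2 / d i" by simp
  qed
  finally show ?thesis using B by simp
qed

lemma lower_part_symmetric:
  assumes A: "A \<in> carrier_mat n n" and sym: "transpose_mat A = A"
  shows "lower_part A + transpose_mat (lower_part A) - A = mat_diag n (\<lambda>i. A $$ (i, i))"
proof -
  have "A $$ (i, j) = A $$ (j, i)" if "i < n" "j < n" for i j
    using that A sym by (metis carrier_matD index_transpose_mat(1))
  then show ?thesis
    using A by (intro eq_matI) (auto simp: lower_part_def mat_diag_def)
qed

lemma spd_mat_diag_pos:
  assumes "spd_mat n A" and i: "i < n"
  shows "0 < A $$ (i, i)"
proof -
  have A: "A \<in> carrier_mat n n" using assms by (simp add: spd_mat_def)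
  have "unit_vec n i \<noteq> (0\<^sub>v n :: real vec)"
    using i by (metis index_unit_vec(1) index_zero_vec(1) zero_neq_one)
  then have "0 < unit_vec n i \<bullet> (A *\<^sub>v unit_vec n i)"
    using assms by (simp add: spd_mat_def)
  also have "\<dots> = A $$ (i, i)"
    using A i by simp
  finally show ?thesis .
qed

lemma sym_gauss_seidel_dominates:
  assumes A: "spd_mat n A" and x: "x \<in> carrier_vec n"
  shows "x \<bullet> (A *\<^sub>v x) \<le> x \<bullet> (sym_gauss_seidel A *\<^sub>v x)"
  unfolding sym_gauss_seidel_def
proof (rule symmetrized_dominates)
  show "lower_part A + transpose_mat (lower_part A) - A = mat_diag n (\<lambda>i. A $$ (i, i))"
    using A by (intro lower_part_symmetric) (auto simp: spd_mat_def)
qed (use A x spd_mat_diag_pos in \<open>auto simp: spd_mat_def lower_part_def\<close>)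

lemma sym_gauss_seidel_carrier:
  assumes "spd_mat n A"
  shows "sym_gauss_seidel A \<in> carrier_mat n n"
  using assms by (auto simp: spd_mat_def sym_gauss_seidel_def symmetrized_def lower_part_def)

section \<open>Restriction to generalized eigenvectors\<close>

lemma index_restricted:
  assumes S: "S \<in> carrier_mat n m" and N: "N \<in> carrier_mat n n" and "i < m" "j < m"
  shows "restricted S N $$ (i, j) = col S i \<bullet> (N *\<^sub>v col S j)"
proof -
  have "restricted S N = transpose_mat S * (N * S)"
    using S N by (simp add: restricted_def assoc_mult_mat[of _ m n _ n _ m])
  then show ?thesis
    using assms by (simp add: mult_mat_vec_def)
qed

lemma gen_eigensystem_form:
  assumes A: "A \<in> carrier_mat n n" and B: "B \<in> carrier_mat n n"
    and sys: "ordered_gen_eigensystem n A B lam v"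
    and i: "i \<in> {1..n}" and j: "j \<in> {1..n}"
  shows "v i \<bullet> (A *\<^sub>v v j) = (if i = j then lam j else 0)"
proof -
  have v: "v k \<in> carrier_vec n" if "k \<in> {1..n}" for k
    using sys that A by (auto simp: ordered_gen_eigensystem_def gen_eigenvector_def)
  have "A *\<^sub>v v j = lam j \<cdot>\<^sub>v (B *\<^sub>v v j)"
    and "v i \<bullet> (B *\<^sub>v v j) = (if i = j then 1 else 0)"
    using sys i j by (auto simp: ordered_gen_eigensystem_def gen_eigenvector_def)
  then show ?thesis
    using v[OF i] v[OF j] B by (simp add: scalar_prod_smult_distrib[of _ n] mult_mat_vec_carrier[of _ n n])
qed

theorem mainTheorem4:
  fixes n nc :: nat and A Mt S :: "real mat"
    and lam :: "nat \<Rightarrow> real" and v :: "nat \<Rightarrow> real vec"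
  assumes "1 \<le> nc" and "nc < n"
    and "spd_mat n A"
    and "Mt = sym_gauss_seidel A"
    and "ordered_gen_eigensystem n A Mt lam v"
    and "S = S_sharp n nc v"
  shows "restricted S Mt = 1\<^sub>m (n - nc) \<and>
    restricted S A = Lambda_sharp n nc lam \<and>
    real_spectral_radius (cr_error_propagation A Mt S)
           = 1 - Min {Lambda_sharp n nc lam $$ (i, i) | i. i < n - nc} \<and>
    1 - Min {Lambda_sharp n nc lam $$ (i, i) | i. i < n - nc} = 1 - lam (nc + 1)"
proof -
  let ?m = "n - nc" and ?L = "Lambda_sharp n nc lam"
  have A: "A \<in> carrier_mat n n" using assms(3) by (simp add: spd_mat_def)
  have Mt: "Mt \<in> carrier_mat n n" using assms(3,4) by (simp add: sym_gauss_seidel_carrier)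
  have v: "v k \<in> carrier_vec n" if "k \<in> {1..n}" for k
    using assms(5) that A by (auto simp: ordered_gen_eigensystem_def gen_eigenvector_def)
  have orth: "v i \<bullet> (Mt *\<^sub>v v j) = (if i = j then 1 else 0)" if "i \<in> {1..n}" "j \<in> {1..n}" for i j
    using assms(5) that by (auto simp: ordered_gen_eigensystem_def)
  have mono: "lam i \<le> lam j" if "1 \<le> i" "i \<le> j" "j \<le> n" for i j
    using assms(5) that by (auto simp: ordered_gen_eigensystem_def)
  note form = gen_eigensystem_form[OF A Mt assms(5)]
  have le1: "lam i \<le> 1" if "i \<in> {1..n}" for i
    using sym_gauss_seidel_dominates[OF assms(3) v[OF that]] form[OF that that] orth[OF that that]
    by (simp add: assms(4))

  have S: "S \<in> carrier_mat n ?m"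
    using mat_of_cols_carrier(1)[of n "map v [nc + 1 ..< n + 1]"]
    by (simp add: assms(6) S_sharp_def del: upt_Suc)
  have colS: "col S j = v (nc + 1 + j)" if "j < ?m" for j
    unfolding assms(6) S_sharp_def
    using that v[of "nc + 1 + j"] by (subst col_mat_of_cols) (auto simp del: upt_Suc)

  have RM: "restricted S Mt = 1\<^sub>m ?m"
  proof (rule eq_matI)
    fix i j assume "i < dim_row (1\<^sub>m ?m :: real mat)" "j < dim_col (1\<^sub>m ?m :: real mat)"
    then show "restricted S Mt $$ (i, j) = 1\<^sub>m ?m $$ (i, j)"
      using orth[of "nc + 1 + i" "nc + 1 + j"] by (simp add: index_restricted[OF S Mt] colS)
  qed (use S in \<open>auto simp: restricted_def\<close>)
  have RA: "restricted S A = ?L"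
  proof (rule eq_matI)
    fix i j assume "i < dim_row ?L" "j < dim_col ?L"
    then have "i < ?m" "j < ?m" by (auto simp: Lambda_sharp_def mat_diag_def)
    then show "restricted S A $$ (i, j) = ?L $$ (i, j)"
      using form[of "nc + 1 + i" "nc + 1 + j"]
      by (simp add: index_restricted[OF S A] colS Lambda_sharp_def mat_diag_def)
  qed (use S in \<open>auto simp: restricted_def Lambda_sharp_def mat_diag_def\<close>)

  have "{?L $$ (i, i) | i. i < ?m} = (\<lambda>i. lam (nc + 1 + i)) ` {..<?m}"
    by (force simp: Lambda_sharp_def mat_diag_def)
  also have "Min \<dots> = lam (nc + 1)"
  proof (rule Min_eqI)
    show "lam (nc + 1) \<in> (\<lambda>i. lam (nc + 1 + i)) ` {..<?m}"
      using assms(2) by (intro image_eqI[of _ _ 0]) auto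
  qed (auto intro!: mono)
  finally have Min: "Min {?L $$ (i, i) | i. i < ?m} = lam (nc + 1)" .

  have "matinv (1\<^sub>m ?m) = 1\<^sub>m ?m" by (rule matinv_eqI) auto
  then have "cr_error_propagation A Mt S = 1\<^sub>m ?m - ?L"
    using S by (simp add: cr_error_propagation_def RM RA Lambda_sharp_def
        left_mult_one_mat[OF mat_diag_dim])
  also have "\<dots> = mat_diag ?m (\<lambda>i. 1 - lam (nc + 1 + i))"
    by (rule eq_matI) (auto simp: Lambda_sharp_def mat_diag_def)
  finally have "real_spectral_radius (cr_error_propagation A Mt S)
      = Max ((\<lambda>i. \<bar>1 - lam (nc + 1 + i)\<bar>) ` {..<?m})"
    by (simp add: real_spectral_radius_mat_diag)
  also have "\<dots> = 1 - lam (nc + 1)"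
  proof (rule Max_eqI)
    show "1 - lam (nc + 1) \<in> (\<lambda>i. \<bar>1 - lam (nc + 1 + i)\<bar>) ` {..<?m}"
      using assms(2) le1[of "nc + 1"] by (intro image_eqI[of _ _ 0]) auto
  next
    fix r assume "r \<in> (\<lambda>i. \<bar>1 - lam (nc + 1 + i)\<bar>) ` {..<?m}"
    then obtain i where "i < ?m" and r: "r = \<bar>1 - lam (nc + 1 + i)\<bar>" by auto
    then show "r \<le> 1 - lam (nc + 1)"
      using le1[of "nc + 1 + i"] mono[of "nc + 1" "nc + 1 + i"] by auto
  qed simp
  finally show ?thesis using RM RA Min by simp
qed

end
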